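(* There is an algorithm that, given a cobipartite graph $G$ of order $n$, enumerates all minimal Roman dominating functions of $G$ in time $\mathcal{O}^*(1.4656^n)$.
   Context: All graphs are finite, undirected and simple. A cobipartite graph is a graph whose vertex set can be partitioned into two cliques (equivalently, the complement of a bipartite graph). For a graph $G=(V,E)$, a function $f\colon V\to\{0,1,2\}$ is a Roman dominating function (rdf) if every vertex $v$ with $f(v)=0$ has a neighbor $u$ with $f(u)=2$. Functions $V\to\{0,1,2\}$ are ordered pointwise: $f\le g$ iff $f(v)\le g(v)$ for all $v\in V$. An rdf $f$ is minimal if there is no rdf $g\neq f$ with $g\le f$. The notation $\mathcal{O}^*(\cdot)$ suppresses factors polynomial in $n$. *)

theory Defs
  imports Complex_Main "HOL-Library.FuncSet" "HOL-Library.Landau_Symbols"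
    "HOL-Computational_Algebra.Polynomial"
begin

definition simple_graph :: "'a set \<Rightarrow> 'a set set \<Rightarrow> bool" where
  "simple_graph V E \<longleftrightarrow> finite V \<and> (\<forall>e\<in>E. e \<subseteq> V \<and> card e = 2)"

definition clique :: "'a set set \<Rightarrow> 'a set \<Rightarrow> bool" where
  "clique E A \<longleftrightarrow> (\<forall>u\<in>A. \<forall>v\<in>A. u \<noteq> v \<longrightarrow> {u, v} \<in> E)"

text \<open>Either of the two cliques may be empty, as for the complement of a bipartite graph.\<close>

definition cobipartite :: "'a set \<Rightarrow> 'a set set \<Rightarrow> bool" where
  "cobipartite V E \<longleftrightarrow> simple_graph V E \<and>
     (\<exists>A B. A \<union> B = V \<and> A \<inter> B = {} \<and> clique E A \<and> clique E B)"

text \<open>Functions on \<open>V\<close> are represented extensionally, so that distinct HOL functions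
  satisfying \<open>rdf V E\<close> are distinct as functions on \<open>V\<close>.\<close>

definition rdf :: "'a set \<Rightarrow> 'a set set \<Rightarrow> ('a \<Rightarrow> nat) \<Rightarrow> bool" where
  "rdf V E f \<longleftrightarrow> f \<in> V \<rightarrow>\<^sub>E {0, 1, 2} \<and>
     (\<forall>v\<in>V. f v = 0 \<longrightarrow> (\<exists>u\<in>V. {u, v} \<in> E \<and> f u = 2))"

definition minimal_rdf :: "'a set \<Rightarrow> 'a set set \<Rightarrow> ('a \<Rightarrow> nat) \<Rightarrow> bool" where
  "minimal_rdf V E f \<longleftrightarrow> rdf V E f \<and>
     \<not> (\<exists>g. rdf V E g \<and> g \<noteq> f \<and> (\<forall>v\<in>V. g v \<le> f v))"

definition O_star :: "(nat \<Rightarrow> real) \<Rightarrow> (nat \<Rightarrow> real) set" where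
  "O_star h = {g. \<exists>p :: real poly. g \<in> O(\<lambda>n. poly p (real n) * h n)}"

text \<open>
  The model of computation is a first-order, call-by-value functional language (pure Lisp) over
  binary trees. A program is a finite list of function bodies, which may call each other
  recursively. Variables are de Bruijn indices into an environment: a body is evaluated in the
  environment consisting of its arguments, \<open>Let\<close> pushes one value, and the second branch of
  \<open>Case\<close> pushes the two components of the pair.

  The last argument of \<open>eval\<close> counts the rule applications in the derivation. Trees are immutable
  and can be shared, and the length of every environment is bounded by a constant depending only
  on the program, so each rule amounts to a bounded number of operations on pointers, that is, on
  words of logarithmic length. Hence a count of \<open>t\<close> corresponds to time \<open>O(t)\<close> on a
  random access machine and to \<open>O(t)\<close> times a power of \<open>log t\<close> at logarithmic cost.
\<close>

datatype val = Null | Pair val val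

datatype exp =
    Var nat
  | NullE
  | PairE exp exp
  | Let exp exp
  | Case exp exp exp
  | Call nat "exp list"

type_synonym program = "exp list"

inductive eval :: "program \<Rightarrow> val list \<Rightarrow> exp \<Rightarrow> val \<Rightarrow> nat \<Rightarrow> bool"
  and evals :: "program \<Rightarrow> val list \<Rightarrow> exp list \<Rightarrow> val list \<Rightarrow> nat \<Rightarrow> bool"
  for P :: program where
  Var: "i < length env \<Longrightarrow> eval P env (Var i) (env ! i) 1"
| NullE: "eval P env NullE Null 1"
| PairE: "eval P env a x s \<Longrightarrow> eval P env b y t \<Longrightarrow>
    eval P env (PairE a b) (Pair x y) (Suc (s + t))"
| Let: "eval P env a x s \<Longrightarrow> eval P (x # env) b y t \<Longrightarrow>
    eval P env (Let a b) y (Suc (s + t))"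
| Case_Null: "eval P env a Null s \<Longrightarrow> eval P env b z t \<Longrightarrow>
    eval P env (Case a b c) z (Suc (s + t))"
| Case_Pair: "eval P env a (Pair x y) s \<Longrightarrow> eval P (x # y # env) c z t \<Longrightarrow>
    eval P env (Case a b c) z (Suc (s + t))"
| Call: "evals P env as xs s \<Longrightarrow> k < length P \<Longrightarrow> eval P xs (P ! k) y t \<Longrightarrow>
    eval P env (Call k as) y (Suc (s + t))"
| Nil: "evals P env [] [] 1"
| Cons: "eval P env a x s \<Longrightarrow> evals P env as xs t \<Longrightarrow>
    evals P env (a # as) (x # xs) (Suc (s + t))"

inductive_cases eval_VarE: "eval P env (Var i) y t"
inductive_cases eval_NullEE: "eval P env NullE y t"
inductive_cases eval_PairEE: "eval P env (PairE a b) y t"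
inductive_cases eval_LetE: "eval P env (Let a b) y t"
inductive_cases eval_CaseE: "eval P env (Case a b c) y t"
inductive_cases eval_CallE: "eval P env (Call k as) y t"
inductive_cases evals_NilE: "evals P env [] ys t"
inductive_cases evals_ConsE: "evals P env (a # as) ys t"

lemma eval_deterministic:
  "eval P env e x s \<Longrightarrow> eval P env e y t \<Longrightarrow> x = y \<and> s = t"
  "evals P env es xs s \<Longrightarrow> evals P env es ys t \<Longrightarrow> xs = ys \<and> s = t"
proof (induction arbitrary: y t and ys t rule: eval_evals.inducts)
  case Var then show ?case by (auto elim: eval_VarE)
next
  case NullE then show ?case by (auto elim: eval_NullEE)
next
  case PairE from PairE.prems PairE.IH show ?case by (elim eval_PairEE) blast
next
  case Let from Let.prems Let.IH show ?case by (elim eval_LetE) blast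
next
  case Case_Null from Case_Null.prems Case_Null.IH show ?case by (elim eval_CaseE) blast+
next
  case Case_Pair from Case_Pair.prems Case_Pair.IH show ?case by (elim eval_CaseE) blast+
next
  case Call from Call.prems Call.IH show ?case by (elim eval_CallE) blast
next
  case Nil then show ?case by (auto elim: evals_NilE)
next
  case Cons from Cons.prems Cons.IH show ?case by (elim evals_ConsE) blast
qed

definition run :: "program \<Rightarrow> val \<Rightarrow> val \<Rightarrow> nat \<Rightarrow> bool" where
  "run P x y t \<longleftrightarrow> eval P [x] (Call 0 [Var 0]) y t"

fun enc_list :: "val list \<Rightarrow> val" where
  "enc_list [] = Null"
| "enc_list (x # xs) = Pair x (enc_list xs)"

definition enc_bool :: "bool \<Rightarrow> val" where
  "enc_bool b = (if b then Pair Null Null else Null)"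

definition enc_nat :: "nat \<Rightarrow> val" where
  "enc_nat n = enc_list (replicate n Null)"

text \<open>The input is the adjacency matrix, and the output a list of value tables, both with
  respect to an enumeration \<open>vs\<close> of the vertices.\<close>

definition enc_graph :: "'a list \<Rightarrow> 'a set set \<Rightarrow> val" where
  "enc_graph vs E = enc_list (map (\<lambda>u. enc_list (map (\<lambda>v. enc_bool ({u, v} \<in> E)) vs)) vs)"

definition enc_functions :: "'a list \<Rightarrow> ('a \<Rightarrow> nat) list \<Rightarrow> val" where
  "enc_functions vs fs = enc_list (map (\<lambda>f. enc_list (map (\<lambda>v. enc_nat (f v)) vs)) fs)"

end

(*
  A minimal Roman dominating function f is determined by D = {v. f v = 2}: it is 0 on the other
  neighbours of D and 1 elsewhere. The sets D that occur are those in which every vertex v has an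
  external private neighbour, that is, some w outside D whose only neighbour in D is v. In a
  cobipartite graph such a D is a clique or consists of two nonadjacent vertices, because two
  nonadjacent members together dominate every other vertex. If D is a clique with
  first vertex u, then all other members are neighbours of u and all their private neighbours are
  non-neighbours of u. So no bipartition has to be computed: for each u one branches on whether a
  neighbour v of u belongs to D, and a chosen v uses up its whole neighbourhood in the set F of
  undominated vertices. Let m be the number of non-isolated vertices of the bipartite graph between
  the undecided vertices and F. If v has at least two neighbours in F, then m drops by 1 or by at
  least 3. Once all degrees are at most 1, choosing v removes v, its neighbour w and all other
  vertices attached to w, so m drops by 1 and 3, or by 2 and 2 if v is alone at w. Hence there are
  at most c^m leaves for every c with c^3 >= c^2 + 1 and c^2 >= 2, and the least c is about 1.46557.
*)

theory Submission
  imports Defs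
begin

subsection \<open>Symbolic execution\<close>

text \<open>A weakest precondition for total correctness, with the cost as second argument of the
  postcondition. By \<open>eval_deterministic\<close> nothing is lost by only asking that some
  derivation exists.\<close>

definition wp :: "program \<Rightarrow> val list \<Rightarrow> exp \<Rightarrow> (val \<Rightarrow> nat \<Rightarrow> bool) \<Rightarrow> bool" where
  "wp P env e Q \<longleftrightarrow> (\<exists>y t. eval P env e y t \<and> Q y t)"

definition wps :: "program \<Rightarrow> val list \<Rightarrow> exp list \<Rightarrow> (val list \<Rightarrow> nat \<Rightarrow> bool) \<Rightarrow> bool" where
  "wps P env es Q \<longleftrightarrow> (\<exists>ys t. evals P env es ys t \<and> Q ys t)"

lemma wp_Var [simp]: "i < length env \<Longrightarrow> wp P env (Var i) Q \<longleftrightarrow> Q (env ! i) 1"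
  unfolding wp_def by (metis eval_evals.Var eval_VarE)

lemma wp_NullE [simp]: "wp P env NullE Q \<longleftrightarrow> Q Null 1"
  unfolding wp_def by (metis eval_evals.NullE eval_NullEE)

lemma wp_PairE [simp]: "wp P env (PairE a b) Q \<longleftrightarrow>
    wp P env a (\<lambda>x s. wp P env b (\<lambda>y t. Q (Pair x y) (Suc (s + t))))"
  unfolding wp_def by (blast intro: eval_evals.intros elim: eval_PairEE)

lemma wp_Case [simp]: "wp P env (Case a b c) Q \<longleftrightarrow>
    wp P env a (\<lambda>v s. case v of
        Null \<Rightarrow> wp P env b (\<lambda>z t. Q z (Suc (s + t)))
      | Pair x y \<Rightarrow> wp P (x # y # env) c (\<lambda>z t. Q z (Suc (s + t))))"
    (is "?L \<longleftrightarrow> ?R")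
proof
  assume ?L then show ?R
    unfolding wp_def by (fastforce elim: eval_CaseE)
next
  assume ?R
  then obtain v s where v: "eval P env a v s"
    "case v of Null \<Rightarrow> wp P env b (\<lambda>z t. Q z (Suc (s + t)))
      | Pair x y \<Rightarrow> wp P (x # y # env) c (\<lambda>z t. Q z (Suc (s + t)))"
    unfolding wp_def[of P env a] by blast
  then show ?L
    by (cases v) (auto simp: wp_def intro: eval_evals.intros)
qed

lemma wps_Nil [simp]: "wps P env [] Q \<longleftrightarrow> Q [] 1"
  unfolding wps_def by (metis eval_evals.Nil evals_NilE)

lemma wps_Cons [simp]: "wps P env (e # es) Q \<longleftrightarrow>
    wp P env e (\<lambda>x s. wps P env es (\<lambda>xs t. Q (x # xs) (Suc (s + t))))"
  unfolding wp_def wps_def by (blast intro: eval_evals.intros elim: evals_ConsE)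

lemma wp_Call [simp]: "wp P env (Call k es) Q \<longleftrightarrow>
    wps P env es (\<lambda>xs s. k < length P \<and> wp P xs (P ! k) (\<lambda>y t. Q y (Suc (s + t))))"
  unfolding wp_def wps_def by (blast intro: eval_evals.intros elim: eval_CallE)

text \<open>The exact cost as a function of the arguments, which gives a rewritten call a closed
  term for its time.\<close>

definition steps :: "program \<Rightarrow> nat \<Rightarrow> val list \<Rightarrow> nat" where
  "steps P k xs = (THE t. \<exists>y. eval P xs (P ! k) y t)"

text \<open>By determinism a specification that merely bounds the time can be turned into an equation, with which
  the simplifier executes calls.\<close>

lemma wp_function:
  assumes "wp P xs (P ! k) (\<lambda>y t. y = r \<and> t \<le> b)"
  shows "wp P xs (P ! k) Q \<longleftrightarrow> Q r (steps P k xs)" "steps P k xs \<le> b"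
proof -
  obtain t where t: "eval P xs (P ! k) r t" "t \<le> b"
    using assms by (auto simp: wp_def)
  then have "steps P k xs = t"
    unfolding steps_def using eval_deterministic(1) by (intro the_equality) blast+
  then show "wp P xs (P ! k) Q \<longleftrightarrow> Q r (steps P k xs)" "steps P k xs \<le> b"
    using t eval_deterministic(1) by (auto simp: wp_def) blast
qed

subsection \<open>The program\<close>

abbreviation (input) TrueE :: exp where "TrueE \<equiv> PairE NullE NullE"

text \<open>Sets are passed as characteristic vectors along the vertex list, and a vertex as the pair of the
  vector of its singleton and its row of the adjacency matrix \<open>M\<close>. Each function body is preceded by its
  index and its arguments; \<open>rows\<close> and \<open>D'\<close> stand for tails of \<open>M\<close> and of the vector of \<open>D\<close> at the
  same position. Functions 9 to 13 extend the list \<open>acc\<close> of tables.\<close>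

abbreviation (input) main_exp :: exp where
  \<comment> \<open>0: [M]\<close>
  "main_exp \<equiv>
     Call 13 [Call 14 [Var 0, NullE], Call 9 [Call 4 [Var 0], NullE, Var 0], Var 0]"

abbreviation (input) card_int_exp :: exp where
  \<comment> \<open>1: [A, B]\<close>
  "card_int_exp \<equiv>
     Case (Var 0) NullE (Case (Var 3) NullE
       (Case (Var 2) (Call 1 [Var 3, Var 1])
         (Case (Var 2) (Call 1 [Var 5, Var 3]) (PairE NullE (Call 1 [Var 7, Var 5])))))"

abbreviation (input) card_diff_exp :: exp where
  \<comment> \<open>2: [A, B]\<close>
  "card_diff_exp \<equiv>
     Case (Var 0) NullE (Case (Var 3) NullE
       (Case (Var 2) (Call 2 [Var 3, Var 1])
         (Case (Var 2) (PairE NullE (Call 2 [Var 5, Var 3])) (Call 2 [Var 7, Var 5]))))"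

abbreviation (input) union_exp :: exp where
  \<comment> \<open>3: [A, B]\<close>
  "union_exp \<equiv>
     Case (Var 0) NullE (Case (Var 3) NullE
       (PairE (Case (Var 2) (Var 0) TrueE) (Call 3 [Var 3, Var 1])))"

abbreviation (input) zeros_exp :: exp where
  \<comment> \<open>4: [xs]\<close>
  "zeros_exp \<equiv>
     Case (Var 0) NullE (PairE NullE (Call 4 [Var 1]))"

abbreviation (input) append_exp :: exp where
  \<comment> \<open>5: [xs, ys]\<close>
  "append_exp \<equiv>
     Case (Var 0) (Var 1) (PairE (Var 0) (Call 5 [Var 1, Var 3]))"

abbreviation (input) unique_exp :: exp where
  \<comment> \<open>6: [rows, D', D]: the vertices outside D with exactly one neighbour in D\<close>
  "unique_exp \<equiv>
     Case (Var 0) NullE (Case (Var 3) NullE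
       (PairE (Case (Var 0) (Case (Call 1 [Var 2, Var 6]) NullE (Case (Var 1) TrueE NullE)) NullE)
         (Call 6 [Var 3, Var 1, Var 6])))"

abbreviation (input) check_exp :: exp where
  \<comment> \<open>7: [rows, D', Q]: whether every vertex of D among the rows has a neighbour in Q\<close>
  "check_exp \<equiv>
     Case (Var 0) TrueE (Case (Var 3) TrueE
       (Case (Var 0) (Call 7 [Var 3, Var 1, Var 6])
         (Case (Call 1 [Var 4, Var 8]) NullE (Call 7 [Var 7, Var 5, Var 10]))))"

abbreviation (input) out_exp :: exp where
  \<comment> \<open>8: [rows, D', D]: the table of the function determined by D\<close>
  "out_exp \<equiv>
     Case (Var 0) NullE (Case (Var 3) NullE
       (PairE (Case (Var 0) (Case (Call 1 [Var 2, Var 6]) TrueE NullE) (PairE NullE TrueE))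
         (Call 8 [Var 3, Var 1, Var 6])))"

abbreviation (input) leaf_exp :: exp where
  \<comment> \<open>9: [D, acc, M]\<close>
  "leaf_exp \<equiv>
     Case (Call 7 [Var 2, Var 0, Call 6 [Var 2, Var 0, Var 0]]) (Var 1)
       (PairE (Call 8 [Var 4, Var 2, Var 2]) (Var 3))"

abbreviation (input) narrow_exp :: exp where
  \<comment> \<open>10: [S, X, D, acc, M]\<close>
  "narrow_exp \<equiv>
     Case (Var 0) (Call 9 [Var 2, Var 3, Var 4])
       (Case (Var 0) NullE
         (Case (Call 2 [Var 1, Var 5])
           (Call 10 [Var 3, Var 5, Var 6, Var 7, Var 8])
           (Call 10 [Var 5, Call 3 [Var 7, Var 3], Call 3 [Var 8, Var 2],
              Call 10 [Var 5, Var 7, Var 8, Var 9, Var 10], Var 10])))"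

abbreviation (input) wide_exp :: exp where
  \<comment> \<open>11: [U, S, X, D, acc, M]\<close>
  "wide_exp \<equiv>
     Case (Var 0) (Call 10 [Var 1, Var 2, Var 3, Var 4, Var 5])
       (Case (Var 0) NullE
         (Case (Call 2 [Var 1, Var 6])
           (Call 11 [Var 3, PairE (Var 2) (Var 5), Var 6, Var 7, Var 8, Var 9])
           (Case (Var 1)
             (Call 11 [Var 5, PairE (Var 4) (Var 7), Var 8, Var 9, Var 10, Var 11])
             (Call 11 [Var 7, Var 9, Call 3 [Var 10, Var 5], Call 3 [Var 11, Var 4],
                Call 11 [Var 7, Var 9, Var 10, Var 11, Var 12, Var 13], Var 13]))))"

abbreviation (input) scan_exp :: exp where
  \<comment> \<open>12: [rest, u, U, acc, M]\<close>
  "scan_exp \<equiv>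
     Case (Var 0)
       (Case (Var 1) NullE
         (Call 11 [Var 4, NullE, Call 3 [Var 0, Var 1], Var 0, Var 5, Var 6]))
       (Case (Var 0) NullE (Case (Var 5) NullE
         (Case (Call 1 [Var 0, Var 3])
           (Call 12 [Var 5, Var 7, Var 8, Call 9 [Call 3 [Var 0, Var 2], Var 9, Var 10], Var 10])
           (Call 12 [Var 7, Var 9, PairE (Var 6) (Var 10), Var 11, Var 12]))))"

abbreviation (input) loop_exp :: exp where
  \<comment> \<open>13: [us, acc, M]\<close>
  "loop_exp \<equiv>
     Case (Var 0) (Var 1)
       (Call 13 [Var 1, Call 12 [Var 1, Var 0, NullE, Var 3, Var 4], Var 4])"

abbreviation (input) entries_exp :: exp where
  \<comment> \<open>14: [rows, zeros], where zeros is as long as the part of M before rows\<close>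
  "entries_exp \<equiv>
     Case (Var 0) NullE
       (PairE (PairE (Call 5 [Var 3, PairE TrueE (Call 4 [Var 1])]) (Var 0))
         (Call 14 [Var 1, PairE NullE (Var 3)]))"

definition prog :: program where
  "prog = [main_exp, card_int_exp, card_diff_exp, union_exp, zeros_exp,
     append_exp, unique_exp, check_exp, out_exp, leaf_exp,
     narrow_exp, wide_exp, scan_exp, loop_exp, entries_exp]"

lemma length_prog [simp]: "length prog = 15"
  by (simp add: prog_def)

text \<open>Not declared as simplification rules: \<open>subst\<close> unfolds just one body, and
  the calls in it are rewritten by their specifications. \<open>Suc 0\<close> is the simplifier's
  form of the index 1.\<close>

lemma prog_nth:
  shows prog_main: "prog ! 0 = main_exp"
    and prog_card_int: "prog ! Suc 0 = card_int_exp"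
    and prog_card_diff: "prog ! 2 = card_diff_exp"
    and prog_union: "prog ! 3 = union_exp"
    and prog_zeros: "prog ! 4 = zeros_exp"
    and prog_append: "prog ! 5 = append_exp"
    and prog_unique: "prog ! 6 = unique_exp"
    and prog_check: "prog ! 7 = check_exp"
    and prog_out: "prog ! 8 = out_exp"
    and prog_leaf: "prog ! 9 = leaf_exp"
    and prog_narrow: "prog ! 10 = narrow_exp"
    and prog_wide: "prog ! 11 = wide_exp"
    and prog_scan: "prog ! 12 = scan_exp"
    and prog_loop: "prog ! 13 = loop_exp"
    and prog_entries: "prog ! 14 = entries_exp"
  by (simp_all add: prog_def)

section \<open>Encodings and operations on characteristic vectors\<close>

lemma enc_bool_simps [simp]: "enc_bool True = Pair Null Null" "enc_bool False = Null"
  by (simp_all add: enc_bool_def)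

lemma enc_nat_simps [simp]: "enc_nat 0 = Null" "enc_nat (Suc n) = Pair Null (enc_nat n)"
  by (simp_all add: enc_nat_def)

text \<open>The list is a parameter because the inductions run over parts of the vertex
  list.\<close>

definition chi :: "'a list \<Rightarrow> 'a set \<Rightarrow> val" where
  "chi ws A = enc_list (map (\<lambda>v. enc_bool (v \<in> A)) ws)"

lemma chi_Nil [simp]: "chi [] A = Null"
  and chi_Cons [simp]: "chi (w # ws) A = Pair (enc_bool (w \<in> A)) (chi ws A)"
  by (simp_all add: chi_def)

lemma case_enc_bool [simp]:
  "(case enc_bool b of Null \<Rightarrow> x | Pair u v \<Rightarrow> f u v) = (if b then f Null Null else x)"
  by simp

lemma case_enc_nat [simp]:
  "(case enc_nat k of Null \<Rightarrow> x | Pair u v \<Rightarrow> f u v) =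
    (case k of 0 \<Rightarrow> x | Suc m \<Rightarrow> f Null (enc_nat m))"
  by (cases k) simp_all

text \<open>Counting positions keeps distinctness out of the induction; \<open>wp_card_int\<close>
  passes to cardinalities. The constant 20 covers one round of the recursion.\<close>

lemma wp_card_int_filter: "wp prog [chi ws A, chi ws B] (prog ! Suc 0) (\<lambda>y t.
   y = enc_nat (length (filter (\<lambda>v. v \<in> A \<and> v \<in> B) ws)) \<and> t \<le> 20 * length ws + 20)"
proof (induction ws)
  case Nil
  then show ?case by (subst prog_card_int) simp
next
  case (Cons w ws)
  note [simp] = wp_function(1)[OF Cons] and t = wp_function(2)[OF Cons]
  show ?case using t by (cases "w \<in> A"; cases "w \<in> B"; subst prog_card_int) simp_all
qed

lemma wp_card_diff_filter: "wp prog [chi ws A, chi ws B] (prog ! 2) (\<lambda>y t.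
   y = enc_nat (length (filter (\<lambda>v. v \<in> A \<and> v \<notin> B) ws)) \<and> t \<le> 20 * length ws + 20)"
proof (induction ws)
  case Nil
  then show ?case by (subst prog_card_diff) simp
next
  case (Cons w ws)
  note [simp] = wp_function(1)[OF Cons] and t = wp_function(2)[OF Cons]
  show ?case using t by (cases "w \<in> A"; cases "w \<in> B"; subst prog_card_diff) simp_all
qed

lemma wp_union: "wp prog [chi ws A, chi ws B] (prog ! 3) (\<lambda>y t.
   y = chi ws (A \<union> B) \<and> t \<le> 20 * length ws + 20)"
proof (induction ws)
  case Nil
  then show ?case by (subst prog_union) simp
next
  case (Cons w ws)
  note [simp] = wp_function(1)[OF Cons] and t = wp_function(2)[OF Cons]
  show ?case using t by (cases "w \<in> A"; subst prog_union) simp_all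
qed

lemma wp_zeros: "wp prog [enc_list (map f ws)] (prog ! 4) (\<lambda>y t.
   y = chi ws {} \<and> t \<le> 20 * length ws + 20)"
proof (induction ws)
  case Nil
  then show ?case by (subst prog_zeros) simp
next
  case (Cons w ws)
  note [simp] = wp_function(1)[OF Cons] and t = wp_function(2)[OF Cons]
  show ?case using t by (subst prog_zeros) simp_all
qed

lemma wp_append: "wp prog [enc_list xs, enc_list ys] (prog ! 5) (\<lambda>y t.
   y = enc_list (xs @ ys) \<and> t \<le> 20 * length xs + 20)"
proof (induction xs)
  case Nil
  then show ?case by (subst prog_append) simp
next
  case (Cons x xs)
  note [simp] = wp_function(1)[OF Cons] and t = wp_function(2)[OF Cons]
  show ?case using t by (subst prog_append) simp_all
qed

locale listed_graph =
  fixes vs :: "'a list" and E :: "'a set set"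
  assumes graph: "simple_graph (set vs) E" and dist: "distinct vs"
begin

definition N :: "'a \<Rightarrow> 'a set" where "N u = {v. {u, v} \<in> E}"

definition row :: "'a \<Rightarrow> val" where "row u = chi vs (N u)"

definition M :: val where "M = enc_list (map row vs)"

definition n :: nat where "n = length vs"

lemma N_subset: "N u \<subseteq> set vs"
  using graph by (auto simp: N_def simple_graph_def)

lemma finite_N [simp]: "finite (N u)"
  using N_subset finite_subset by blast

lemma N_sym: "v \<in> N u \<longleftrightarrow> u \<in> N v"
  by (simp add: N_def insert_commute)

lemma N_outside: "u \<notin> set vs \<Longrightarrow> N u = {}"
  using N_sym N_subset by blast

lemma wp_card_int:
  assumes "A \<subseteq> set vs"
  shows "wp prog [chi vs A, chi vs B] (prog ! Suc 0) (\<lambda>y t.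
   y = enc_nat (card (A \<inter> B)) \<and> t \<le> 20 * n + 20)"
proof -
  have "{v. v \<in> A \<and> v \<in> B} \<inter> set vs = A \<inter> B" using assms by blast
  then show ?thesis
    using wp_card_int_filter[of vs A B] by (simp add: distinct_length_filter[OF dist] n_def)
qed

lemma wp_card_diff:
  assumes "A \<subseteq> set vs"
  shows "wp prog [chi vs A, chi vs B] (prog ! 2) (\<lambda>y t.
   y = enc_nat (card (A - B)) \<and> t \<le> 20 * n + 20)"
proof -
  have "{v. v \<in> A \<and> v \<notin> B} \<inter> set vs = A - B" using assms by blast
  then show ?thesis
    using wp_card_diff_filter[of vs A B] by (simp add: distinct_length_filter[OF dist] n_def)
qed

lemmas wp_card_int_row = wp_card_int[OF N_subset, folded row_def]
lemmas wp_card_diff_row = wp_card_diff[OF N_subset, folded row_def]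

text \<open>The external private neighbours of all members of \<open>D\<close> together.\<close>

definition unique :: "'a set \<Rightarrow> 'a set" where
  "unique D = {w. w \<notin> D \<and> card (N w \<inter> D) = 1}"

lemma wp_unique: "wp prog [enc_list (map row ws), chi ws D, chi vs D] (prog ! 6) (\<lambda>y t.
   y = chi ws (unique D) \<and> t \<le> (20 * n + 60) * (length ws + 1))"
proof (induction ws)
  case Nil
  then show ?case by (subst prog_unique) simp
next
  case (Cons w ws)
  note [simp] = wp_function(1)[OF Cons] wp_function(1)[OF wp_card_int_row]
  show ?case using wp_function(2)[OF Cons] wp_function(2)[OF wp_card_int_row[of w D]]
    by (cases "w \<in> D"; subst prog_unique) (auto simp: unique_def algebra_simps split: nat.split)
qed

lemma wp_check: "wp prog [enc_list (map row ws), chi ws D, chi vs Q] (prog ! 7) (\<lambda>y t.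
   y = enc_bool (\<forall>w\<in>set ws. w \<in> D \<longrightarrow> N w \<inter> Q \<noteq> {}) \<and> t \<le> (20 * n + 60) * (length ws + 1))"
proof (induction ws)
  case Nil
  then show ?case by (subst prog_check) simp
next
  case (Cons w ws)
  note [simp] = wp_function(1)[OF Cons] wp_function(1)[OF wp_card_int_row]
  show ?case using wp_function(2)[OF Cons] wp_function(2)[OF wp_card_int_row[of w Q]]
    by (cases "w \<in> D"; cases "N w \<inter> Q = {}"; subst prog_check) (auto simp: algebra_simps split: nat.split)
qed

definition table :: "'a set \<Rightarrow> 'a \<Rightarrow> nat" where
  "table D w = (if w \<in> D then 2 else if N w \<inter> D = {} then 1 else 0)"

lemma wp_out: "wp prog [enc_list (map row ws), chi ws D, chi vs D] (prog ! 8) (\<lambda>y t.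
   y = enc_list (map (\<lambda>w. enc_nat (table D w)) ws) \<and> t \<le> (20 * n + 60) * (length ws + 1))"
proof (induction ws)
  case Nil
  then show ?case by (subst prog_out) simp
next
  case (Cons w ws)
  note [simp] = wp_function(1)[OF Cons] wp_function(1)[OF wp_card_int_row]
  show ?case using wp_function(2)[OF Cons] wp_function(2)[OF wp_card_int_row[of w D]]
    by (cases "w \<in> D"; subst prog_out)
      (auto simp: table_def numeral_2_eq_2 algebra_simps split: nat.split)
qed

text \<open>These are the open irredundant sets. They contain listed vertices only, since other
  vertices have no neighbours.\<close>

definition irredundant :: "'a set \<Rightarrow> bool" where
  "irredundant D \<longleftrightarrow> (\<forall>w\<in>D. N w \<inter> unique D \<noteq> {})"

definition tables :: "'a set list \<Rightarrow> val" where
  "tables Ds = enc_list (map (\<lambda>D. enc_list (map (\<lambda>w. enc_nat (table D w)) vs)) Ds)"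

section \<open>The enumeration as recursion on sets, and its number of calls\<close>

definition leaf :: "'a set \<Rightarrow> 'a set list \<Rightarrow> 'a set list" where
  "leaf D acc = (if irredundant D then D # acc else acc)"

text \<open>\<open>X\<close> consists of the vertices that are dominated by \<open>D\<close> or known to lie in \<open>D\<close>. The vertices deferred by \<open>wide\<close>
  have at most one neighbour outside \<open>X\<close>, and this persists because \<open>X\<close> only grows.\<close>

primrec narrow :: "'a list \<Rightarrow> 'a set \<Rightarrow> 'a set \<Rightarrow> 'a set list \<Rightarrow> 'a set list" where
  "narrow [] X D acc = leaf D acc"
| "narrow (v # S) X D acc = (if N v \<subseteq> X then narrow S X D acc
     else narrow S (X \<union> N v) (insert v D) (narrow S X D acc))"

primrec wide :: "'a list \<Rightarrow> 'a list \<Rightarrow> 'a set \<Rightarrow> 'a set \<Rightarrow> 'a set list \<Rightarrow> 'a set list" where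
  "wide [] S X D acc = narrow S X D acc"
| "wide (v # U) S X D acc = (if card (N v - X) \<le> 1 then wide U (v # S) X D acc
     else wide U S (X \<union> N v) (insert v D) (wide U S X D acc))"

text \<open>Treats the sets with first member \<open>u\<close>. Later neighbours are collected for
  the clique case, and each later non-neighbour gives one pair. The search starts with the closed
  neighbourhood of \<open>u\<close> as \<open>X\<close>, since a vertex in it is not private to
  another member.\<close>

primrec scan :: "'a list \<Rightarrow> 'a \<Rightarrow> 'a list \<Rightarrow> 'a set list \<Rightarrow> 'a set list" where
  "scan [] u U acc = wide U [] (insert u (N u)) {u} acc"
| "scan (v # ws) u U acc = (if u \<in> N v then scan ws u (v # U) acc
     else scan ws u U (leaf {u, v} acc))"

text \<open>Every nonempty set is found at its first member, hence only later vertices are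
  scanned.\<close>

primrec loop :: "'a list \<Rightarrow> 'a set list \<Rightarrow> 'a set list" where
  "loop [] acc = acc"
| "loop (u # us) acc = loop us (scan us u [] acc)"

text \<open>The branching depends on \<open>S\<close> and \<open>X\<close> alone, so the chosen set
  and the accumulator do not occur.\<close>

primrec calls_narrow :: "'a list \<Rightarrow> 'a set \<Rightarrow> nat" where
  "calls_narrow [] X = 1"
| "calls_narrow (v # S) X = (if N v \<subseteq> X then 1 + calls_narrow S X
     else 1 + calls_narrow S X + calls_narrow S (X \<union> N v))"

primrec calls_wide :: "'a list \<Rightarrow> 'a list \<Rightarrow> 'a set \<Rightarrow> nat" where
  "calls_wide [] S X = 1 + calls_narrow S X"
| "calls_wide (v # U) S X = (if card (N v - X) \<le> 1 then 1 + calls_wide U (v # S) X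
     else 1 + calls_wide U S X + calls_wide U S (X \<union> N v))"

primrec calls_scan :: "'a list \<Rightarrow> 'a \<Rightarrow> 'a list \<Rightarrow> nat" where
  "calls_scan [] u U = 1 + calls_wide U [] (insert u (N u))"
| "calls_scan (v # ws) u U = 1 + calls_scan ws u (if u \<in> N v then v # U else U)"

primrec calls_loop :: "'a list \<Rightarrow> nat" where
  "calls_loop [] = 1"
| "calls_loop (u # us) = 1 + calls_scan us u [] + calls_loop us"

text \<open>Bounds the time that one call spends outside its recursive calls.\<close>

definition K :: nat where "K = 300 * (n + 1)\<^sup>2"

text \<open>The first bound is for the three passes over the matrix in a leaf, the second for the
  linear work of the other calls.\<close>

lemma K_ge: "3 * ((20 * n + 60) * (n + 1)) + 60 \<le> K" "200 * n + 200 \<le> K"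
  by (simp_all add: K_def power2_eq_square algebra_simps)

section \<open>Running time in terms of the number of calls\<close>

lemma wp_leaf:
  assumes "D \<subseteq> set vs"
  shows "wp prog [chi vs D, tables acc, M] (prog ! 9) (\<lambda>y t.
   y = tables (leaf D acc) \<and> t \<le> K)"
proof -
  note specs = wp_unique[of vs D, folded M_def n_def] wp_check[of vs D "unique D", folded M_def n_def]
    wp_out[of vs D, folded M_def n_def]
  note [simp] = specs[THEN wp_function(1)]
  have irredundant: "irredundant D \<longleftrightarrow> (\<forall>w\<in>set vs. w \<in> D \<longrightarrow> N w \<inter> unique D \<noteq> {})"
    using assms by (auto simp: irredundant_def)
  show ?thesis using specs[THEN wp_function(2)] K_ge(1)
    by (subst prog_leaf) (simp add: irredundant leaf_def tables_def)
qed

definition entry :: "'a \<Rightarrow> val" where "entry u = Pair (chi vs {u}) (row u)"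

lemma case_entry [simp]:
  "(case entry u of Null \<Rightarrow> x | Pair a b \<Rightarrow> f a b) = f (chi vs {u}) (row u)"
  by (simp add: entry_def)

abbreviation entries :: "'a list \<Rightarrow> val" where "entries us \<equiv> enc_list (map entry us)"

text \<open>Each call is charged \<open>2 * K\<close>: one \<open>K\<close> for a possible leaf, the
  other for the remaining work.\<close>

lemma wp_narrow:
  assumes "D \<subseteq> set vs" "set S \<subseteq> set vs"
  shows "wp prog [entries S, chi vs X, chi vs D, tables acc, M] (prog ! 10) (\<lambda>y t.
   y = tables (narrow S X D acc) \<and> t \<le> 2 * K * calls_narrow S X)"
  using assms
proof (induction S arbitrary: X D acc)
  case Nil
  note [simp] = wp_function(1)[OF wp_leaf[of D], OF Nil(1)]
  show ?case using wp_function(2)[OF wp_leaf[of D acc]] Nil(1) K_ge(2)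
    by (subst prog_narrow) simp
next
  case (Cons v S)
  then have IH: "D' \<subseteq> set vs \<Longrightarrow> wp prog [entries S, chi vs X', chi vs D', tables acc', M] (prog ! 10)
      (\<lambda>y t. y = tables (narrow S X' D' acc') \<and> t \<le> 2 * K * calls_narrow S X')" for X' D' acc'
    by simp
  have D: "D \<subseteq> set vs" "insert v D \<subseteq> set vs" using Cons.prems by auto
  note specs = wp_card_diff_row[of v X]
    wp_union[of vs X "N v", folded n_def row_def] wp_union[of vs D "{v}", folded n_def, simplified]
    IH[of D X acc] IH[of "insert v D" "X \<union> N v" "narrow S X D acc"]
  note [simp] = specs[THEN wp_function(1)]
  have [simp]: "card (N v - X) = 0" if "N v \<subseteq> X" using that by simp
  \<comment> \<open>A nonzero count in successor form lets the program's case distinction on the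
    unary number compute.\<close>
  consider "N v \<subseteq> X" | m where "\<not> N v \<subseteq> X" "card (N v - X) = Suc m"
    by (metis card_0_eq finite_Diff finite_N Diff_eq_empty_iff not0_implies_Suc)
  then show ?case using D specs[THEN wp_function(2)] K_ge(2)
    by (cases; subst prog_narrow) (simp_all add: add_mult_distrib2)
qed

lemma wp_wide:
  assumes "D \<subseteq> set vs" "set S \<subseteq> set vs" "set U \<subseteq> set vs"
  shows "wp prog [entries U, entries S, chi vs X, chi vs D, tables acc, M] (prog ! 11) (\<lambda>y t.
   y = tables (wide U S X D acc) \<and> t \<le> 2 * K * calls_wide U S X)"
  using assms
proof (induction U arbitrary: S X D acc)
  case Nil
  note [simp] = wp_function(1)[OF wp_narrow, OF Nil(1,2)]
  show ?case using wp_function(2)[OF wp_narrow, OF Nil(1,2), of X acc] K_ge(2)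
    by (subst prog_wide) simp
next
  case (Cons v U)
  have IH: "wp prog [entries U, entries S', chi vs X', chi vs D', tables acc', M] (prog ! 11)
      (\<lambda>y t. y = tables (wide U S' X' D' acc') \<and> t \<le> 2 * K * calls_wide U S' X')"
    if "D' \<subseteq> set vs" "set S' \<subseteq> set vs" for X' D' S' acc'
    using Cons that by simp
  \<comment> \<open>The program builds this list with an explicit \<open>Pair\<close>, so the
    rewrite rule needs the unfolded form.\<close>
  have IH': "wp prog [entries U, Pair (entry v) (entries S), chi vs X, chi vs D, tables acc, M] (prog ! 11)
      (\<lambda>y t. y = tables (wide U (v # S) X D acc) \<and> t \<le> 2 * K * calls_wide U (v # S) X)"
    using IH[of D "v # S" X acc] Cons.prems by simp
  have D: "D \<subseteq> set vs" "insert v D \<subseteq> set vs" "set S \<subseteq> set vs" using Cons.prems by auto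
  note specs = wp_card_diff_row[of v X]
    wp_union[of vs X "N v", folded n_def row_def] wp_union[of vs D "{v}", folded n_def, simplified]
    IH[of D S X acc] IH[of "insert v D" S "X \<union> N v" "wide U S X D acc"] IH'
  note [simp] = specs[THEN wp_function(1)]
  have [simp]: "card (N v - X) = 0" if "N v \<subseteq> X" using that by simp
  consider "N v \<subseteq> X" | "card (N v - X) = 1" | m where "card (N v - X) = Suc (Suc m)"
    by (metis One_nat_def card_0_eq finite_Diff finite_N Diff_eq_empty_iff not0_implies_Suc)
  then show ?case using D specs[THEN wp_function(2)] K_ge(2)
    by (cases; subst prog_wide) (simp_all add: add_mult_distrib2)
qed

lemma wp_scan:
  assumes "u \<in> set vs" "set ws \<subseteq> set vs" "set U \<subseteq> set vs"
  shows "wp prog [entries ws, entry u, entries U, tables acc, M] (prog ! 12) (\<lambda>y t.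
   y = tables (scan ws u U acc) \<and> t \<le> 2 * K * calls_scan ws u U)"
  using assms(2,3)
proof (induction ws arbitrary: U acc)
  case Nil
  have "wp prog [entries U, Null, chi vs (insert u (N u)), chi vs {u}, tables acc, M] (prog ! 11) (\<lambda>y t.
     y = tables (wide U [] (insert u (N u)) {u} acc) \<and> t \<le> 2 * K * calls_wide U [] (insert u (N u)))"
    using wp_wide[of "{u}" "[]" U] Nil assms(1) by simp
  note specs = this wp_union[of vs "{u}" "N u", folded n_def row_def, simplified]
  note [simp] = specs[THEN wp_function(1)]
  show ?case using specs[THEN wp_function(2)] K_ge(2)
    by (subst prog_scan) (simp add: add_mult_distrib2)
next
  case (Cons v ws)
  have "wp prog [entries ws, entry u, Pair (entry v) (entries U), tables acc, M] (prog ! 12) (\<lambda>y t.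
      y = tables (scan ws u (v # U) acc) \<and> t \<le> 2 * K * calls_scan ws u (v # U))"
    and "wp prog [entries ws, entry u, entries U, tables (leaf {u, v} acc), M] (prog ! 12) (\<lambda>y t.
      y = tables (scan ws u U (leaf {u, v} acc)) \<and> t \<le> 2 * K * calls_scan ws u U)"
    using Cons.IH[of "v # U"] Cons.IH[of U] Cons.prems by simp_all
  moreover have "{u, v} \<subseteq> set vs" "{u} \<subseteq> set vs" using assms(1) Cons.prems by simp_all
  \<comment> \<open>Adjacency of \<open>u\<close> and \<open>v\<close> is tested by intersecting the
    singleton of \<open>u\<close> with the row of \<open>v\<close>.\<close>
  ultimately have specs: "wp prog [entries ws, entry u, Pair (entry v) (entries U), tables acc, M] (prog ! 12) (\<lambda>y t.
      y = tables (scan ws u (v # U) acc) \<and> t \<le> 2 * K * calls_scan ws u (v # U))"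
    "wp prog [entries ws, entry u, entries U, tables (leaf {u, v} acc), M] (prog ! 12) (\<lambda>y t.
      y = tables (scan ws u U (leaf {u, v} acc)) \<and> t \<le> 2 * K * calls_scan ws u U)"
    "wp prog [chi vs {u}, row v] (prog ! Suc 0) (\<lambda>y t.
      y = enc_nat (card ({u} \<inter> N v)) \<and> t \<le> 20 * n + 20)"
    "wp prog [chi vs {u, v}, tables acc, M] (prog ! 9) (\<lambda>y t.
      y = tables (leaf {u, v} acc) \<and> t \<le> K)"
    "wp prog [chi vs {u}, chi vs {v}] (prog ! 3) (\<lambda>y t. y = chi vs {u, v} \<and> t \<le> 20 * n + 20)"
    using wp_card_int[of "{u}" "N v", folded row_def] wp_leaf[of "{u, v}"]
      wp_union[of vs "{u}" "{v}", folded n_def, simplified]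
    by (simp_all add: insert_commute)
  note [simp] = specs[THEN wp_function(1)]
  show ?case using specs[THEN wp_function(2)] K_ge(2)
    by (cases "u \<in> N v"; subst prog_scan) (simp_all add: add_mult_distrib2)
qed

lemma wp_loop:
  assumes "set us \<subseteq> set vs"
  shows "wp prog [entries us, tables acc, M] (prog ! 13) (\<lambda>y t.
    y = tables (loop us acc) \<and> t \<le> 2 * K * calls_loop us)"
  using assms
proof (induction us arbitrary: acc)
  case Nil
  show ?case using K_ge(2) by (subst prog_loop) simp
next
  case (Cons u us)
  then have "wp prog [entries us, entry u, Null, tables acc, M] (prog ! 12) (\<lambda>y t.
     y = tables (scan us u [] acc) \<and> t \<le> 2 * K * calls_scan us u [])"
    using wp_scan[of u us "[]"] by simp
  moreover have "wp prog [entries us, tables (scan us u [] acc), M] (prog ! 13) (\<lambda>y t.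
    y = tables (loop us (scan us u [] acc)) \<and> t \<le> 2 * K * calls_loop us)"
    using Cons by simp
  note specs = calculation this
  note [simp] = specs[THEN wp_function(1)]
  show ?case using specs[THEN wp_function(2)] K_ge(2)
    by (subst prog_loop) (simp add: add_mult_distrib2)
qed

lemma wp_entries:
  assumes "vs = us @ ws"
  shows "wp prog [enc_list (map row ws), chi us {}] (prog ! 14) (\<lambda>y t.
    y = entries ws \<and> t \<le> (100 + 40 * n) * (length ws + 1))"
  using assms
proof (induction ws arbitrary: us)
  case Nil
  show ?case by (subst prog_entries) simp
next
  case (Cons w ws)
  \<comment> \<open>The program lengthens the zero vector at the front, the induction at the back;
    with equal entries both agree.\<close>
  have zeros_snoc: "Pair Null (chi xs {}) = chi (xs @ [x]) {}" for xs :: "'a list" and x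
    by (induction xs) simp_all
  have len: "length us \<le> n" "length ws \<le> n" using arg_cong[OF Cons.prems, of length] by (simp_all add: n_def)
  have "w \<notin> set us" "w \<notin> set ws"
    using dist Cons.prems by simp_all
  \<comment> \<open>Since \<open>w\<close> occurs only once in \<open>vs\<close>, zeros, a one and
    zeros form the vector of its singleton.\<close>
  then have "chi us {} = enc_list (map (\<lambda>v. enc_bool (v \<in> {w})) us)"
    "Pair (Pair Null Null) (chi ws {}) = enc_list (map (\<lambda>v. enc_bool (v \<in> {w})) (w # ws))"
    by (auto simp: chi_def enc_bool_def intro!: arg_cong[of _ _ enc_list])
  then have "wp prog [chi us {}, Pair (Pair Null Null) (chi ws {})] (prog ! 5) (\<lambda>y t.
      y = chi vs {w} \<and> t \<le> 20 * length us + 20)"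
    using wp_append[of "map (\<lambda>v. enc_bool (v \<in> {w})) us" "map (\<lambda>v. enc_bool (v \<in> {w})) (w # ws)"]
    by (simp add: chi_def Cons.prems)
  moreover have "wp prog [enc_list (map row ws), Pair Null (chi us {})] (prog ! 14) (\<lambda>y t.
    y = entries ws \<and> t \<le> (100 + 40 * n) * (length ws + 1))"
    using Cons.IH[of "us @ [w]"] Cons.prems by (simp add: zeros_snoc[of us w])
  note specs = calculation this wp_zeros[of row ws]
  note [simp] = specs[THEN wp_function(1)]
  show ?case using specs[THEN wp_function(2)] len
    by (subst prog_entries) (simp add: entry_def add_mult_distrib2)
qed

text \<open>The empty set has no first member; it enters through the initial accumulator
  \<open>leaf {} []\<close>.\<close>

lemma run_prog:
  "\<exists>t. run prog M (tables (loop vs (leaf {} []))) t \<and> t \<le> 4 * K * (calls_loop vs + 1)"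
proof -
  have "wp prog [M, Null] (prog ! 14) (\<lambda>y t. y = entries vs \<and> t \<le> (100 + 40 * n) * (n + 1))"
    using wp_entries[of "[]" vs] by (simp add: M_def n_def)
  moreover have "wp prog [M] (prog ! 4) (\<lambda>y t. y = chi vs {} \<and> t \<le> 20 * n + 20)"
    using wp_zeros[of row vs] by (simp add: M_def n_def)
  moreover have "wp prog [chi vs {}, Null, M] (prog ! 9) (\<lambda>y t. y = tables (leaf {} []) \<and> t \<le> K)"
    using wp_leaf[of "{}" "[]"] by (simp add: tables_def)
  note specs = calculation this wp_loop[of vs "leaf {} []", simplified]
  note [simp] = specs[THEN wp_function(1)]
  have "(100 + 40 * n) * (n + 1) \<le> K" by (simp add: K_def power2_eq_square algebra_simps)
  then have "wp prog [M] (Call 0 [Var 0]) (\<lambda>y t. y = tables (loop vs (leaf {} []))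
      \<and> t \<le> 4 * K * (calls_loop vs + 1))"
    using specs[THEN wp_function(2)] K_ge(2) by (simp add: prog_main add_mult_distrib2)
  then show ?thesis by (auto simp: wp_def run_def)
qed

subsection \<open>Correctness\<close>

lemma irredundant_private:
  assumes "irredundant D" "v \<in> D"
  obtains w where "w \<in> N v" "w \<notin> D" "N w \<inter> D = {v}"
proof -
  obtain w where w: "w \<in> N v" "w \<notin> D" "card (N w \<inter> D) = 1"
    using assms by (auto simp: irredundant_def unique_def)
  moreover have "v \<in> N w \<inter> D" using w N_sym assms by blast
  ultimately show ?thesis using that by (metis card_1_singletonE singletonD)
qed

lemma irredundant_subset: "irredundant D \<Longrightarrow> D \<subseteq> set vs"
  using N_outside by (auto simp: irredundant_def)

text \<open>The solutions below a node of the search tree with chosen vertices \<open>D\<close> and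
  undecided vertices \<open>U\<close>.\<close>

definition between :: "'a set \<Rightarrow> 'a set \<Rightarrow> 'a set set" where
  "between D U = {D'. irredundant D' \<and> D \<subseteq> D' \<and> D' \<subseteq> D \<union> U}"

text \<open>A private neighbour of a newly added \<open>v\<close> would lie in \<open>X\<close>,
  hence in \<open>D\<close> or next to a member of \<open>D\<close> other than \<open>v\<close>.
  This justifies the pruning in \<open>narrow\<close>.\<close>

lemma between_skip:
  assumes "N v \<subseteq> X" "X \<subseteq> D \<union> \<Union> (N ` D)"
  shows "between D (insert v U) = between D U"
proof -
  have "v \<in> D" if D': "irredundant D'" "D \<subseteq> D'" "v \<in> D'" for D'
  proof -
    obtain w where w: "w \<in> N v" "w \<notin> D'" "N w \<inter> D' = {v}"
      using irredundant_private D' by metis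
    then obtain d where "d \<in> D" "w \<in> N d" using assms D'(2) by auto
    then have "d \<in> N w \<inter> D'" using D'(2) N_sym[of w d] by blast
    then show ?thesis using w(3) \<open>d \<in> D\<close> by simp
  qed
  then show ?thesis by (auto simp: between_def)
qed

lemma between_branch: "between D (insert v U) = between D U \<union> between (insert v D) U"
  by (auto simp: between_def)

lemma between_disjoint: "v \<notin> D \<Longrightarrow> v \<notin> U \<Longrightarrow> between D U \<inter> between (insert v D) U = {}"
  by (auto simp: between_def)

lemma set_leaf: "set (leaf D acc) = set acc \<union> between D {}"
  by (auto simp: leaf_def between_def)

text \<open>Keeps up the invariant behind \<open>between_skip\<close>: \<open>X\<close> lies in the
  closed neighbourhood of \<open>D\<close>.\<close>

lemma closure_step: "X \<subseteq> D \<union> \<Union> (N ` D) \<Longrightarrow> X \<union> N v \<subseteq> insert v D \<union> \<Union> (N ` insert v D)"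
  by auto

lemma set_narrow:
  "X \<subseteq> D \<union> \<Union> (N ` D) \<Longrightarrow> set (narrow S X D acc) = set acc \<union> between D (set S)"
proof (induction S arbitrary: X D acc)
  case Nil
  then show ?case by (simp add: set_leaf)
next
  case (Cons v S)
  show ?case
    using Cons.IH[OF Cons.prems] Cons.IH[OF closure_step[OF Cons.prems, of v]]
      between_skip[OF _ Cons.prems] between_branch by auto
qed

text \<open>Deferral merely moves a vertex from \<open>U\<close> to \<open>S\<close>; the degree
  test influences the number of calls, not what is found.\<close>

lemma set_wide:
  "X \<subseteq> D \<union> \<Union> (N ` D) \<Longrightarrow> set (wide U S X D acc) = set acc \<union> between D (set U \<union> set S)"
proof (induction U arbitrary: S X D acc)
  case Nil
  then show ?case by (simp add: set_narrow)
next
  case (Cons v U)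
  show ?case
    using Cons.IH[OF Cons.prems] Cons.IH[OF closure_step[OF Cons.prems, of v]]
      between_branch by auto
qed

text \<open>The two branches differ in whether they contain \<open>v\<close>, so the second adds
  nothing that the first has put into the accumulator.\<close>

lemma distinct_narrow:
  assumes "X \<subseteq> D \<union> \<Union> (N ` D)" "distinct S" "D \<inter> set S = {}"
    "distinct acc" "set acc \<inter> between D (set S) = {}"
  shows "distinct (narrow S X D acc)"
  using assms
proof (induction S arbitrary: X D acc)
  case Nil
  then show ?case by (auto simp: leaf_def between_def)
next
  case (Cons v S)
  have "set (narrow S X D acc) \<inter> between (insert v D) (set S) = {}"
    using Cons.prems between_disjoint[of v D "set S"]
    by (simp add: set_narrow between_branch) blast
  then show ?case
    using Cons.IH[of X D acc] Cons.IH[of "X \<union> N v" "insert v D" "narrow S X D acc"]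
      Cons.prems closure_step[of X D v]
    by (simp add: between_branch Int_Un_distrib)
qed

lemma distinct_wide:
  assumes "X \<subseteq> D \<union> \<Union> (N ` D)" "distinct (U @ S)" "D \<inter> (set U \<union> set S) = {}"
    "distinct acc" "set acc \<inter> between D (set U \<union> set S) = {}"
  shows "distinct (wide U S X D acc)"
  using assms
proof (induction U arbitrary: S X D acc)
  case Nil
  then show ?case by (simp add: distinct_narrow)
next
  case (Cons v U)
  have "set (wide U S X D acc) \<inter> between (insert v D) (set U \<union> set S) = {}"
    using Cons.prems between_disjoint[of v D "set U \<union> set S"]
    by (simp add: set_wide between_branch) blast
  then show ?case
    using Cons.IH[of X D S acc] Cons.IH[of "X \<union> N v" "insert v D" S "wide U S X D acc"]
      Cons.IH[of X D "v # S" acc] Cons.prems closure_step[of X D v]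
    by (simp add: between_branch Int_Un_distrib)
qed

lemma closure_init: "insert u (N u) \<subseteq> {u} \<union> \<Union> (N ` {u})"
  by auto

lemma set_scan:
  "set (scan ws u U acc) = set acc \<union> between {u} (set U \<union> (set ws \<inter> N u))
     \<union> {D. irredundant D \<and> (\<exists>v\<in>set ws - N u. D = {u, v})}"
proof (induction ws arbitrary: U acc)
  case Nil
  then show ?case by (simp add: set_wide[OF closure_init])
next
  case (Cons v ws)
  show ?case
    by (auto simp: Cons.IH N_sym[of u v] leaf_def)
qed

lemma distinct_scan:
  assumes "u \<notin> set ws" "u \<notin> set U" "distinct (ws @ U)" "set U \<subseteq> N u" "distinct acc"
    "set acc \<inter> between {u} (set U \<union> (set ws \<inter> N u)) = {}"
    "set acc \<inter> {D. irredundant D \<and> (\<exists>v\<in>set ws - N u. D = {u, v})} = {}"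
  shows "distinct (scan ws u U acc)"
  using assms
proof (induction ws arbitrary: U acc)
  case Nil
  then show ?case by (simp add: distinct_wide[OF closure_init])
next
  case (Cons v ws)
  show ?case
  proof (cases "u \<in> N v")
    case True
    then show ?thesis using Cons.IH[of "v # U" acc] Cons.prems N_sym[of u v] by auto
  next
    case False
    \<comment> \<open>All candidates of the clique case are neighbours of \<open>u\<close>, whereas
      \<open>v\<close> is not.\<close>
    have "{u, v} \<notin> between {u} (set U \<union> (set ws \<inter> N u))"
      using False Cons.prems N_sym[of u v] by (auto simp: between_def)
    moreover have "{u, v} \<noteq> {u, v'}" if "v' \<in> set ws - N u" for v'
      using that Cons.prems by (auto simp: doubleton_eq_iff)
    ultimately have "distinct (scan ws u U (leaf {u, v} acc))"
      using Cons.prems False N_sym[of u v]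
      by (intro Cons.IH) (auto simp: leaf_def)
    then show ?thesis using False by simp
  qed
qed

end

section \<open>The shape of the solutions in a cobipartite graph\<close>

locale listed_cobipartite_graph = listed_graph +
  assumes cobip: "cobipartite (set vs) E"
begin

text \<open>If \<open>D\<close> had a non-neighbour \<open>v\<close> of \<open>u\<close> and a third
  member \<open>x\<close>, a private neighbour of \<open>x\<close> would be adjacent to neither
  \<open>u\<close> nor \<open>v\<close>. But \<open>u\<close> and \<open>v\<close> lie in different
  cliques.\<close>

lemma irredundant_shape:
  assumes "irredundant D" "u \<in> D"
  shows "D \<subseteq> insert u (N u) \<or> (\<exists>v. v \<notin> N u \<and> D = {u, v})"
proof (rule ccontr)
  assume *: "\<not> ?thesis"
  then obtain v where v: "v \<in> D" "v \<noteq> u" "v \<notin> N u" by blast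
  then obtain x where x: "x \<in> D" "x \<noteq> u" "x \<noteq> v" using * assms(2) by blast
  obtain w where w: "w \<in> N x" "w \<notin> D" "N w \<inter> D = {x}" using irredundant_private assms(1) x(1) by metis
  obtain A B where AB: "A \<union> B = set vs" "clique E A" "clique E B"
    using cobip by (auto simp: cobipartite_def)
  have adj: "a \<in> N b" if "a \<noteq> b" "{a, b} \<subseteq> A \<or> {a, b} \<subseteq> B" for a b
    using AB that by (auto simp: clique_def N_def insert_commute)
  have "w \<in> set vs" "u \<in> set vs" "v \<in> set vs"
    using w N_subset irredundant_subset assms v by blast+
  moreover have "w \<noteq> u" "w \<noteq> v" using w(2) assms(2) v(1) by auto
  moreover have "u \<notin> N w" using w(3) assms(2) x by (metis IntI singletonD)
  moreover have "v \<notin> N w" using w(3) v(1) x by (metis IntI singletonD)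
  \<comment> \<open>If \<open>w\<close> is in one clique, then \<open>u\<close> and \<open>v\<close>
    are both in the other and hence adjacent.\<close>
  ultimately have "w \<notin> A" "w \<notin> B" "u \<in> A \<union> B" "v \<in> A \<union> B"
    using AB(1) adj[of u w] adj[of v w] adj[of v u] v by auto
  then show False using AB(1) \<open>w \<in> set vs\<close> by blast
qed

lemma split_first:
  assumes "u \<notin> set us"
  shows "{D. irredundant D \<and> D \<noteq> {} \<and> D \<subseteq> set (u # us)} =
     between {u} (set us \<inter> N u) \<union> {D. irredundant D \<and> (\<exists>v\<in>set us - N u. D = {u, v})}
     \<union> {D. irredundant D \<and> D \<noteq> {} \<and> D \<subseteq> set us}" (is "?L = ?R")
proof
  show "?L \<subseteq> ?R"
  proof
    fix D assume D: "D \<in> ?L"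
    show "D \<in> ?R"
    proof (cases "u \<in> D")
      case True
      then consider "D \<subseteq> insert u (N u)" | v where "v \<notin> N u" "D = {u, v}"
        using irredundant_shape D by blast
      then show ?thesis
      proof cases
        case 1
        then show ?thesis using D True by (auto simp: between_def)
      next
        case 2
        \<comment> \<open>The pair may degenerate to \<open>{u}\<close>, which falls under the
          clique case.\<close>
        then show ?thesis using D by (cases "v = u") (auto simp: between_def)
      qed
    qed (use D in auto)
  qed
  show "?R \<subseteq> ?L" by (auto simp: between_def)
qed

lemma set_loop:
  "distinct us \<Longrightarrow> set (loop us acc) = set acc \<union> {D. irredundant D \<and> D \<noteq> {} \<and> D \<subseteq> set us}"
proof (induction us arbitrary: acc)
  case (Cons u us)
  then show ?case using split_first[of u us] by (simp add: set_scan Un_assoc)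
qed (auto simp: conj_commute)

lemma distinct_loop:
  assumes "distinct us" "distinct acc" "set acc \<inter> {D. irredundant D \<and> D \<noteq> {} \<and> D \<subseteq> set us} = {}"
  shows "distinct (loop us acc)"
  using assms
proof (induction us arbitrary: acc)
  case (Cons u us)
  have "u \<notin> set us" using Cons.prems by simp
  have "set acc \<inter> (between {u} (set us \<inter> N u) \<union> {D. irredundant D \<and> (\<exists>v\<in>set us - N u. D = {u, v})}
      \<union> {D. irredundant D \<and> D \<noteq> {} \<and> D \<subseteq> set us}) = {}"
    using Cons.prems(3) unfolding split_first[OF \<open>u \<notin> set us\<close>] .
  then have "set acc \<inter> between {u} (set us \<inter> N u) = {}"
    "set acc \<inter> {D. irredundant D \<and> (\<exists>v\<in>set us - N u. D = {u, v})} = {}"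
    and disj: "set acc \<inter> {D. irredundant D \<and> D \<noteq> {} \<and> D \<subseteq> set us} = {}"
    unfolding Int_Un_distrib Un_empty by simp_all
  then have "distinct (scan us u [] acc)"
    using Cons.prems by (intro distinct_scan) simp_all
  \<comment> \<open>All sets added by \<open>scan\<close> contain \<open>u\<close>; the later ones
    avoid it.\<close>
  moreover have "set (scan us u [] acc) \<inter> {D. irredundant D \<and> D \<noteq> {} \<and> D \<subseteq> set us} = {}"
    using disj \<open>u \<notin> set us\<close> unfolding set_scan Int_Un_distrib2 Un_empty
    by (auto simp: between_def)
  ultimately show ?case using Cons by simp
qed (auto simp: conj_commute)

lemma set_result: "set (loop vs (leaf {} [])) = {D. irredundant D}"
  using irredundant_subset by (auto simp: set_loop[OF dist] leaf_def)

lemma distinct_result: "distinct (loop vs (leaf {} []))"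
  using dist by (intro distinct_loop) (auto simp: leaf_def)

end

subsection \<open>Minimal Roman dominating functions\<close>

context listed_graph begin

lemma rdf_iff: "rdf (set vs) E f \<longleftrightarrow> f \<in> set vs \<rightarrow>\<^sub>E {0, 1, 2} \<and>
    (\<forall>v\<in>set vs. f v = 0 \<longrightarrow> (\<exists>u\<in>N v. f u = 2))"
proof -
  have "(\<exists>u\<in>set vs. {u, v} \<in> E \<and> f u = 2) \<longleftrightarrow> (\<exists>u\<in>N v. f u = 2)" for v
    using N_subset[of v] N_sym by (auto simp: N_def)
  then show ?thesis by (simp add: rdf_def)
qed

text \<open>A smaller \<open>g\<close> has value 2 only inside \<open>D\<close>. A private neighbour
  of \<open>v\<close> gets 0 and can rely on \<open>v\<close> alone, so \<open>g\<close> is 2 on all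
  of \<open>D\<close>. A vertex without neighbour in \<open>D\<close> cannot get 0.\<close>

lemma minimal_rdf_table:
  assumes "irredundant D"
  shows "minimal_rdf (set vs) E (restrict (table D) (set vs))" (is "minimal_rdf ?V E ?f")
proof -
  have D: "D \<subseteq> ?V" using irredundant_subset assms .
  have f: "?f v = table D v" if "v \<in> ?V" for v using that by simp
  have "\<exists>u\<in>N v. ?f u = 2" if v: "v \<in> ?V" "?f v = 0" for v
  proof -
    obtain u where "u \<in> N v" "u \<in> D" using v by (auto simp: table_def split: if_splits)
    then show ?thesis using D by (auto simp: table_def intro!: bexI[of _ u])
  qed
  then have rdf: "rdf ?V E ?f" by (auto simp: rdf_iff table_def)
  have "g = ?f" if g: "rdf ?V E g" and le: "\<forall>v\<in>?V. g v \<le> ?f v" for g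
  proof -
    have le: "g v \<le> table D v" if "v \<in> ?V" for v using le f that by metis
    have nbr: "\<exists>u\<in>N v \<inter> D. g u = 2" if v: "v \<in> ?V" "g v = 0" for v
    proof -
      obtain u where u: "u \<in> N v" "g u = 2" using g v by (auto simp: rdf_iff)
      then have "table D u \<ge> 2" using le[of u] N_subset by auto
      then have "u \<in> D" by (simp add: table_def split: if_splits)
      then show ?thesis using u by blast
    qed
    have "g v = table D v" if v: "v \<in> ?V" for v
    proof -
      consider "v \<in> D" | "v \<notin> D" "N v \<inter> D = {}" | "v \<notin> D" "N v \<inter> D \<noteq> {}" by blast
      then show ?thesis
      proof cases
        case 1
        then obtain w where w: "w \<in> N v" "w \<notin> D" "N w \<inter> D = {v}" using irredundant_private assms by metis
        then have "w \<in> ?V" using N_subset by blast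
        then have "g w = 0" using le[of w] w by (simp add: table_def)
        then show ?thesis using nbr[OF \<open>w \<in> ?V\<close>] w 1 by (simp add: table_def)
      next
        case 2
        then have "g v \<noteq> 0" using nbr[OF v] by auto
        then show ?thesis using le[OF v] 2 by (simp add: table_def)
      next
        case 3
        then show ?thesis using le[OF v] by (simp add: table_def)
      qed
    qed
    then show ?thesis
      using g f by (intro extensionalityI[of _ ?V]) (auto simp: rdf_def PiE_def)
  qed
  then show ?thesis using rdf unfolding minimal_rdf_def by blast
qed

text \<open>Minimality is used by lowering single values: a 1 next to \<open>D\<close> could become
  0, and a 2 without private neighbour could become 1.\<close>

lemma minimal_rdf_obtains_table:
  assumes f: "minimal_rdf (set vs) E f"
  obtains D where "irredundant D" "f = restrict (table D) (set vs)"
proof -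
  let ?V = "set vs"
  define D where "D = {v \<in> ?V. f v = 2}"
  have f_rdf: "rdf ?V E f" using f by (simp add: minimal_rdf_def)
  then have range: "f \<in> ?V \<rightarrow>\<^sub>E {0, 1, 2}" by (simp add: rdf_iff)
  have nbr: "N v \<inter> D \<noteq> {}" if v: "v \<in> ?V" "f v = 0" for v
  proof -
    obtain u where "u \<in> N v" "f u = 2" using f_rdf v by (auto simp: rdf_iff)
    moreover then have "u \<in> D" using N_subset by (auto simp: D_def)
    ultimately show ?thesis by blast
  qed
  have no_smaller: "\<not> rdf ?V E (f(v := k))" if "v \<in> ?V" "k < f v" for v k
  proof
    assume "rdf ?V E (f(v := k))"
    moreover have "(f(v := k)) v \<noteq> f v" using that by simp
    then have "f(v := k) \<noteq> f" by metis
    moreover have "\<forall>w\<in>?V. (f(v := k)) w \<le> f w" using that by simp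
    ultimately show False using f unfolding minimal_rdf_def by blast
  qed
  have ext: "f(v := k) \<in> ?V \<rightarrow>\<^sub>E {0, 1, 2}" if "v \<in> ?V" "k \<in> {0, 1, 2}" for v k
    using range that by (auto simp: PiE_iff extensional_def)
  have f_table: "f v = table D v" if v: "v \<in> ?V" for v
  proof -
    have zero: "f v = 0" if v': "v \<notin> D" "N v \<inter> D \<noteq> {}"
    proof (rule ccontr)
      assume "f v \<noteq> 0"
      have "rdf ?V E (f(v := 0))"
      proof (unfold rdf_iff, intro conjI ballI impI ext[OF v])
        fix w assume "w \<in> ?V" "(f(v := 0)) w = 0"
        then have "N w \<inter> D \<noteq> {}" using nbr v'(2) by (cases "w = v") simp_all
        then obtain u where "u \<in> N w" "u \<in> D" by blast
        then show "\<exists>u\<in>N w. (f(v := 0)) u = 2"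
          using v'(1) by (intro bexI[of _ u]) (auto simp: D_def)
      qed simp
      then show False using no_smaller[OF v] \<open>f v \<noteq> 0\<close> by simp
    qed
    have "f v = 1" if "v \<notin> D" "N v \<inter> D = {}"
      using range nbr[OF v] v that by (auto simp: D_def PiE_iff)
    moreover have "f v = 2" if "v \<in> D" using that by (simp add: D_def)
    ultimately show ?thesis using zero by (simp add: table_def)
  qed
  have "f = restrict (table D) ?V"
    using range f_table by (intro extensionalityI[of _ ?V]) (auto simp: PiE_def)
  moreover have "N v \<inter> unique D \<noteq> {}" if "v \<in> D" for v
  proof
    assume none: "N v \<inter> unique D = {}"
    have v: "v \<in> ?V" "f v = 2" using \<open>v \<in> D\<close> by (simp_all add: D_def)
    have "rdf ?V E (f(v := 1))"
    proof (unfold rdf_iff, intro conjI ballI impI ext[OF v(1)])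
      fix w assume w: "w \<in> ?V" "(f(v := 1)) w = 0"
      then have w0: "f w = 0" by (cases "w = v") simp_all
      then have "w \<notin> D" by (simp add: D_def)
      have "N w \<inter> D \<noteq> {v}"
      proof
        assume *: "N w \<inter> D = {v}"
        then have "w \<in> unique D" using \<open>w \<notin> D\<close> by (simp add: unique_def)
        moreover have "w \<in> N v" using * N_sym[of w v] by blast
        ultimately show False using none by blast
      qed
      then obtain u where "u \<in> N w" "u \<in> D" "u \<noteq> v" using nbr[OF w(1) w0] by blast
      then show "\<exists>u\<in>N w. (f(v := 1)) u = 2" by (intro bexI[of _ u]) (simp_all add: D_def)
    qed simp
    then show False using no_smaller[OF v(1), of 1] v(2) by simp
  qed
  ultimately show ?thesis using that unfolding irredundant_def by blast
qed

lemma minimal_rdfs: "{f. minimal_rdf (set vs) E f} = (\<lambda>D. restrict (table D) (set vs)) ` {D. irredundant D}"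
proof
  show "{f. minimal_rdf (set vs) E f} \<subseteq> (\<lambda>D. restrict (table D) (set vs)) ` {D. irredundant D}"
  proof
    fix f assume "f \<in> {f. minimal_rdf (set vs) E f}"
    then obtain D where "irredundant D" "f = restrict (table D) (set vs)"
      using minimal_rdf_obtains_table by auto
    then show "f \<in> (\<lambda>D. restrict (table D) (set vs)) ` {D. irredundant D}" by simp
  qed
qed (auto intro: minimal_rdf_table)

text \<open>The set is recovered as the place of the value 2, so distinct sets yield distinct
  functions.\<close>

lemma inj_on_table: "inj_on (\<lambda>D. restrict (table D) (set vs)) {D. irredundant D}"
proof (rule inj_on_inverseI)
  fix D assume "D \<in> {D. irredundant D}"
  then show "{v \<in> set vs. restrict (table D) (set vs) v = 2} = D"
    using irredundant_subset by (auto simp: table_def split: if_splits)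
qed

end

subsection \<open>Number of calls\<close>

text \<open>Slightly above the real root of \<open>x ^ 3 = x ^ 2 + 1\<close>, which belongs to drops
  of the measure by 1 and 3.\<close>

definition rate :: real where "rate = 1.4656"

lemma rate_ge_1 [simp]: "1 \<le> rate"
  and rate_1_3: "rate ^ 2 + 1 \<le> rate ^ 3"
  and rate_2_2: "2 \<le> rate ^ 2"
  by (simp_all add: rate_def power_numeral_reduce)

lemma rate_power_ge_1 [simp]: "1 \<le> rate ^ k"
  by simp

lemma rate_power_ge_0 [simp]: "0 \<le> rate ^ k"
  by (rule order.trans[OF zero_le_one]) simp

lemma rate_power_mono: "a \<le> b \<Longrightarrow> rate ^ a \<le> rate ^ b"
  by (simp add: power_increasing)

section \<open>The measure and its decrease in each branch\<close>

context listed_graph begin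

text \<open>The number of non-isolated vertices of the bipartite graph between \<open>W\<close> and the complement of \<open>X\<close>.\<close>

definition mu :: "'a set \<Rightarrow> 'a set \<Rightarrow> nat" where
  "mu W X = card {v \<in> W. \<not> N v \<subseteq> X} + card (\<Union> (N ` W) - X)"

lemma finite_pending [simp]: "finite (\<Union> (N ` W) - X)"
  by (rule finite_subset[of _ "set vs"]) (use N_subset in auto)

lemma mu_mono:
  assumes "finite W" "W' \<subseteq> W" "X \<subseteq> X'"
  shows "mu W' X' \<le> mu W X"
proof -
  have "card {v \<in> W'. \<not> N v \<subseteq> X'} \<le> card {v \<in> W. \<not> N v \<subseteq> X}"
    using assms by (intro card_mono) auto
  moreover have "card (\<Union> (N ` W') - X') \<le> card (\<Union> (N ` W) - X)"
    using assms by (intro card_mono) auto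
  ultimately show ?thesis by (simp add: mu_def)
qed

lemma mu_insert:
  assumes "finite W" "v \<notin> W" "\<not> N v \<subseteq> X"
  shows "mu (insert v W) X = Suc (card {v \<in> W. \<not> N v \<subseteq> X}) + card (\<Union> (N ` insert v W) - X)"
proof -
  have "{u \<in> insert v W. \<not> N u \<subseteq> X} = insert v {u \<in> W. \<not> N u \<subseteq> X}"
    using assms by auto
  then show ?thesis using assms by (simp add: mu_def)
qed

lemma mu_drop:
  assumes "finite W" "v \<notin> W" "\<not> N v \<subseteq> X"
  shows "mu W X + 1 \<le> mu (insert v W) X"
proof -
  have "card (\<Union> (N ` W) - X) \<le> card (\<Union> (N ` insert v W) - X)"
    by (intro card_mono finite_pending) auto
  then show ?thesis unfolding mu_insert[OF assms] mu_def[of W] by linarith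
qed

lemma pending_take:
  "card (\<Union> (N ` W) - (X \<union> N v)) + card (N v - X) \<le> card (\<Union> (N ` insert v W) - X)"
proof -
  have "card (\<Union> (N ` W) - (X \<union> N v)) + card (N v - X) =
      card ((\<Union> (N ` W) - (X \<union> N v)) \<union> (N v - X))"
    by (intro card_Un_disjoint[symmetric]) auto
  also have "\<dots> \<le> card (\<Union> (N ` insert v W) - X)"
    by (intro card_mono finite_pending) auto
  finally show ?thesis .
qed

text \<open>Besides \<open>v\<close>, its neighbours outside \<open>X\<close> cease to count,
  because they enter \<open>X\<close>.\<close>

lemma mu_take:
  assumes "finite W" "v \<notin> W" "\<not> N v \<subseteq> X"
  shows "mu W (X \<union> N v) + 1 + card (N v - X) \<le> mu (insert v W) X"
proof -
  have "card {u \<in> W. \<not> N u \<subseteq> X \<union> N v} \<le> card {u \<in> W. \<not> N u \<subseteq> X}"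
    using assms by (intro card_mono) auto
  then show ?thesis
    using pending_take[of W X v] unfolding mu_insert[OF assms] mu_def[of W] by linarith
qed

text \<open>Here \<open>w\<close> is attached to \<open>v\<close> only and is lost together with
  it.\<close>

lemma mu_drop_isolated:
  assumes "finite W" "v \<notin> W" "w \<in> N v - X" "\<forall>u\<in>W. w \<notin> N u"
  shows "mu W X + 2 \<le> mu (insert v W) X"
proof -
  have "card (insert w (\<Union> (N ` W) - X)) \<le> card (\<Union> (N ` insert v W) - X)"
    using assms by (intro card_mono finite_pending) auto
  moreover have "w \<notin> \<Union> (N ` W) - X" "\<not> N v \<subseteq> X" using assms by auto
  ultimately show ?thesis
    using mu_insert[OF assms(1,2), of X] unfolding mu_def[of W] by simp
qed

text \<open>In addition to the loss in \<open>mu_take\<close>, \<open>s\<close> becomes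
  isolated.\<close>

lemma mu_take_shared:
  assumes "finite W" "v \<notin> W" "\<not> N v \<subseteq> X" "s \<in> W" "\<not> N s \<subseteq> X" "N s \<subseteq> X \<union> N v"
  shows "mu W (X \<union> N v) + 2 + card (N v - X) \<le> mu (insert v W) X"
proof -
  have "card (insert s {u \<in> W. \<not> N u \<subseteq> X \<union> N v}) \<le> card {u \<in> W. \<not> N u \<subseteq> X}"
    using assms by (intro card_mono) auto
  moreover have "s \<notin> {u \<in> W. \<not> N u \<subseteq> X \<union> N v}" using assms by auto
  ultimately show ?thesis
    using pending_take[of W X v] assms(1) unfolding mu_insert[OF assms(1-3)] mu_def[of W] by simp
qed

section \<open>Recurrences for the number of calls\<close>

lemma growth_1_3:
  assumes "a + 1 \<le> m" "b + 3 \<le> m"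
  shows "rate ^ a + rate ^ b \<le> rate ^ m"
proof -
  have m: "m - 3 + 3 = m" using assms(2) by linarith
  have "rate ^ a + rate ^ b \<le> rate ^ (m - 3 + 2) + rate ^ (m - 3)"
    using assms by (intro add_mono rate_power_mono) auto
  also have "\<dots> = rate ^ (m - 3) * (rate ^ 2 + 1)"
    by (simp only: power_add distrib_left mult_1_right)
  also have "\<dots> \<le> rate ^ (m - 3) * rate ^ 3"
    using rate_1_3 by (intro mult_left_mono) auto
  also have "\<dots> = rate ^ m" by (simp only: power_add[symmetric] m)
  finally show ?thesis .
qed

lemma growth_2_2:
  assumes "a + 2 \<le> m" "b + 2 \<le> m"
  shows "rate ^ a + rate ^ b \<le> rate ^ m"
proof -
  have m: "m - 2 + 2 = m" using assms(2) by linarith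
  have "rate ^ a + rate ^ b \<le> rate ^ (m - 2) + rate ^ (m - 2)"
    using assms by (intro add_mono rate_power_mono) auto
  also have "\<dots> = rate ^ (m - 2) * 2" by simp
  also have "\<dots> \<le> rate ^ (m - 2) * rate ^ 2"
    using rate_2_2 by (intro mult_left_mono) auto
  also have "\<dots> = rate ^ m" by (simp only: power_add[symmetric] m)
  finally show ?thesis .
qed

text \<open>A full binary tree with \<open>r\<close> leaves has \<open>2 * r - 1\<close> nodes. The
  factor \<open>L\<close>, which grows by one per level, pays for calls that do not branch.\<close>

lemma calls_branch:
  fixes p q r L :: real
  assumes "c \<le> L * (2 * p - 1)" "d \<le> L * (2 * q - 1)" "p + q \<le> r" "1 \<le> r" "0 \<le> L"
  shows "1 + c + d \<le> (L + 1) * (2 * r - 1)"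
proof -
  have "L * (p + q) \<le> L * r" using assms by (intro mult_left_mono) auto
  then show ?thesis using assms by (simp add: algebra_simps)
qed

lemma calls_single:
  fixes p r L :: real
  assumes "c \<le> L * (2 * p - 1)" "p \<le> r" "1 \<le> r" "0 \<le> L"
  shows "1 + c \<le> (L + 1) * (2 * r - 1)"
proof -
  have "L * p \<le> L * r" using assms by (intro mult_left_mono) auto
  then show ?thesis using assms by (simp add: algebra_simps)
qed

lemma calls_narrow_bound:
  assumes "distinct S" "\<forall>s\<in>set S. card (N s - X) \<le> 1"
  shows "real (calls_narrow S X) \<le> real (length S + 1) * (2 * rate ^ mu (set S) X - 1)"
  using assms
proof (induction S arbitrary: X)
  case Nil
  then show ?case by (simp add: mu_def)
next
  case (Cons v S)
  let ?r = "rate ^ mu (set (v # S)) X"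
  have r: "1 \<le> ?r" by simp
  have IH: "real (calls_narrow S X) \<le> real (length S + 1) * (2 * rate ^ mu (set S) X - 1)"
    using Cons by simp
  show ?case
  proof (cases "N v \<subseteq> X")
    case True
    have "rate ^ mu (set S) X \<le> ?r" by (intro rate_power_mono mu_mono) auto
    then show ?thesis using calls_single[OF IH _ r] True by simp
  next
    case False
    have fin: "finite (set S)" "v \<notin> set S" "\<not> N v \<subseteq> X" using Cons.prems False by auto
    have "card (N s - (X \<union> N v)) \<le> 1" if "s \<in> set S" for s
    proof -
      have "card (N s - (X \<union> N v)) \<le> card (N s - X)" by (intro card_mono) auto
      then show ?thesis using Cons.prems that by force
    qed
    then have IH': "real (calls_narrow S (X \<union> N v)) \<le> real (length S + 1) * (2 * rate ^ mu (set S) (X \<union> N v) - 1)"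
      using Cons by simp
    have "card (N v - X) \<le> 1" "card (N v - X) \<noteq> 0" using Cons.prems(2) False by auto
    then have one: "card (N v - X) = 1" by linarith
    then obtain w where w: "N v - X = {w}" by (auto simp: card_1_singleton_iff)
    have "rate ^ mu (set S) X + rate ^ mu (set S) (X \<union> N v) \<le> ?r"
    proof (cases "\<exists>s\<in>set S. w \<in> N s")
      case True
      then obtain s where s: "s \<in> set S" "w \<in> N s" by blast
      have "card (N s - X) \<le> Suc 0" using Cons.prems(2) s by simp
      \<comment> \<open>At most one neighbour of \<open>s\<close> lies outside \<open>X\<close>, and
        \<open>w\<close> is one. Taking \<open>v\<close> thus isolates \<open>s\<close> as well, and
        the drops are 1 and 3.\<close>
      then have "N s - X \<subseteq> {w}"
        using w s by (intro subsetI) (auto simp: card_le_Suc0_iff_eq)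
      then have "\<not> N s \<subseteq> X" "N s \<subseteq> X \<union> N v" using w s by auto
      then show ?thesis
        using mu_take_shared[OF fin s(1)] mu_drop[OF fin] one by (intro growth_1_3) auto
    next
      case False
      \<comment> \<open>Dropping \<open>v\<close> isolates \<open>w\<close>, so both branches lose
        2.\<close>
      then have "mu (set S) X + 2 \<le> mu (insert v (set S)) X"
        using w by (intro mu_drop_isolated[OF fin(1,2), of w]) auto
      then show ?thesis using mu_take[OF fin] one by (intro growth_2_2) auto
    qed
    then show ?thesis using calls_branch[OF IH IH' _ r] fin by simp
  qed
qed

text \<open>A vertex of \<open>U\<close> counts twice, since after deferral it is met again by
  \<open>narrow\<close>.\<close>

lemma calls_wide_bound:
  assumes "distinct (U @ S)" "\<forall>s\<in>set S. card (N s - X) \<le> 1"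
  shows "real (calls_wide U S X) \<le> real (2 * length U + length S + 2) * (2 * rate ^ mu (set U \<union> set S) X - 1)"
  using assms
proof (induction U arbitrary: S X)
  case Nil
  then show ?case using calls_single[OF calls_narrow_bound[of S X], of "rate ^ mu (set S) X"] by (simp add: algebra_simps)
next
  case (Cons v U)
  let ?W = "set U \<union> set S"
  let ?r = "rate ^ mu (insert v ?W) X"
  have r: "1 \<le> ?r" by simp
  show ?case
  proof (cases "card (N v - X) \<le> 1")
    case True
    then have "real (calls_wide U (v # S) X) \<le> real (2 * length U + length S + 3) * (2 * ?r - 1)"
      using Cons.IH[of "v # S" X] Cons.prems by (simp add: algebra_simps)
    from calls_single[OF this order.refl r] show ?thesis
      using True by (simp add: algebra_simps)
  next
    case False
    then have "\<not> N v \<subseteq> X" by (metis Diff_eq_empty_iff card.empty zero_le)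
    then have fin: "finite ?W" "v \<notin> ?W" "\<not> N v \<subseteq> X" using Cons.prems by auto
    have "card (N s - (X \<union> N v)) \<le> 1" if "s \<in> set S" for s
    proof -
      have "card (N s - (X \<union> N v)) \<le> card (N s - X)" by (intro card_mono) auto
      then show ?thesis using Cons.prems that by force
    qed
    then have IH: "real (calls_wide U S X) \<le> real (2 * length U + length S + 2) * (2 * rate ^ mu ?W X - 1)"
      "real (calls_wide U S (X \<union> N v)) \<le> real (2 * length U + length S + 2) * (2 * rate ^ mu ?W (X \<union> N v) - 1)"
      using Cons by simp_all
    have "rate ^ mu ?W X + rate ^ mu ?W (X \<union> N v) \<le> ?r"
      \<comment> \<open>At least two neighbours of \<open>v\<close> lie outside \<open>X\<close>, so
        taking \<open>v\<close> lowers the measure by 3 or more.\<close>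
      using mu_drop[OF fin] mu_take[OF fin] False by (intro growth_1_3) auto
    from calls_branch[OF IH this r] have
      "1 + real (calls_wide U S X) + real (calls_wide U S (X \<union> N v))
        \<le> real (2 * length U + length S + 3) * (2 * ?r - 1)"
      by (simp add: algebra_simps)
    also have "\<dots> \<le> real (2 * length U + length S + 4) * (2 * ?r - 1)"
      using r by (intro mult_right_mono) (simp, linarith)
    finally show ?thesis using False by (simp add: ac_simps)
  qed
qed

text \<open>The undecided vertices lie in \<open>N u\<close> and the undominated ones outside it, so
  together they number at most \<open>n\<close>.\<close>

lemma mu_init:
  assumes "set U \<subseteq> N u"
  shows "mu (set U) (insert u (N u)) \<le> n"
proof -
  have "card {v \<in> set U. \<not> N v \<subseteq> insert u (N u)} \<le> card (N u)"
    using assms by (intro card_mono) auto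
  moreover have "card (\<Union> (N ` set U) - insert u (N u)) \<le> card (set vs - N u)"
    using N_subset by (intro card_mono) auto
  moreover have "card (set vs - N u) = n - card (N u)" "card (N u) \<le> n"
    using N_subset[of u] card_mono[OF _ N_subset[of u]] distinct_card[OF dist]
    by (simp_all add: card_Diff_subset n_def)
  ultimately show ?thesis by (simp add: mu_def)
qed

lemma calls_scan_bound:
  assumes "distinct (ws @ U)" "set U \<subseteq> N u"
  shows "real (calls_scan ws u U) \<le> real (length ws + 1) + real (2 * (length ws + length U) + 2) * (2 * rate ^ n)"
  using assms
proof (induction ws arbitrary: U)
  case Nil
  have "real (calls_wide U [] (insert u (N u))) \<le> real (2 * length U + 2) * (2 * rate ^ mu (set U) (insert u (N u)) - 1)"
    using calls_wide_bound[of U "[]" "insert u (N u)"] Nil by simp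
  also have "\<dots> \<le> real (2 * length U + 2) * (2 * rate ^ n)"
    using rate_power_mono[OF mu_init[of U u]] Nil by (intro mult_left_mono) auto
  finally show ?case by simp
next
  case (Cons v ws)
  show ?case
  proof (cases "u \<in> N v")
    case True
    then have "set (v # U) \<subseteq> N u" "distinct (ws @ v # U)" using Cons.prems N_sym[of u v] by auto
    then show ?thesis using Cons.IH[of "v # U"] True by simp
  next
    case False
    have "real (2 * (length ws + length U) + 2) * (2 * rate ^ n)
        \<le> real (2 * (length (v # ws) + length U) + 2) * (2 * rate ^ n)"
      by (intro mult_right_mono) auto
    then show ?thesis using Cons.IH[of U] Cons.prems False by simp
  qed
qed

lemma calls_loop_bound:
  assumes "distinct us" "set us \<subseteq> set vs"
  shows "real (calls_loop us) \<le> 1 + real (length us) * (6 * (real n + 1) * rate ^ n)"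
  using assms
proof (induction us)
  case (Cons u us)
  have "length us \<le> n"
    using Cons.prems distinct_card[of us] card_mono[of "set vs" "set us"] distinct_card[OF dist]
    by (simp add: n_def)
  have p: "1 \<le> rate ^ n" by simp
  have "real (calls_scan us u []) \<le> real (length us + 1) + real (2 * length us + 2) * (2 * rate ^ n)"
    using calls_scan_bound[of us "[]" u] Cons.prems by simp
  also have "\<dots> \<le> (real n + 1) + (2 * real n + 2) * (2 * rate ^ n)"
    using \<open>length us \<le> n\<close> by (intro add_mono mult_right_mono) auto
  also have "\<dots> = (real n + 1) + 4 * ((real n + 1) * rate ^ n)" by (simp add: algebra_simps)
  finally have "real (calls_scan us u []) \<le> (real n + 1) + 4 * ((real n + 1) * rate ^ n)" .
  \<comment> \<open>These make up \<open>6 = 4 + 1 + 1\<close>: the search, the steps of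
    \<open>scan\<close> and the call of \<open>loop\<close> itself.\<close>
  moreover have "real n + 1 \<le> (real n + 1) * rate ^ n" "1 \<le> (real n + 1) * rate ^ n"
    using mult_left_mono[OF p, of "real n + 1"] mult_mono[of 1 "real n + 1" 1 "rate ^ n"] by simp_all
  moreover have "real (calls_loop us) \<le> 1 + real (length us) * (6 * (real n + 1) * rate ^ n)"
    using Cons by simp
  ultimately show ?case by (simp add: algebra_simps)
qed simp

section \<open>Assembling output and running time\<close>

lemma tables_enc: "tables Ds = enc_functions vs (map (\<lambda>D. restrict (table D) (set vs)) Ds)"
  by (simp add: tables_def enc_functions_def cong: map_cong)

lemma M_enc: "M = enc_graph vs E"
  by (simp add: M_def enc_graph_def row_def[abs_def] chi_def N_def)

end

text \<open>The factor is \<open>8400 = 4 * 300 * 7\<close>; two powers of \<open>n + 1\<close> come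
  from \<open>K\<close> and two from the number of calls.\<close>

definition time_poly :: "real poly" where
  "time_poly = smult 8400 ([:1, 1:] ^ 4)"

lemma (in listed_cobipartite_graph) prog_correct:
  "\<exists>fs t. run prog (enc_graph vs E) (enc_functions vs fs) t \<and>
     real t \<le> poly time_poly (real n) * 1.4656 ^ n \<and>
     distinct fs \<and> set fs = {f. minimal_rdf (set vs) E f}"
proof -
  let ?Ds = "loop vs (leaf {} [])"
  obtain t where t: "run prog M (tables ?Ds) t" "t \<le> 4 * K * (calls_loop vs + 1)"
    using run_prog by blast
  let ?p = "(real n + 1) ^ 2 * rate ^ n"
  have one: "1 \<le> ?p" using mult_mono[of 1 "(real n + 1) ^ 2" 1 "rate ^ n"] by simp
  have "real (calls_loop vs) \<le> 1 + real n * (6 * (real n + 1) * rate ^ n)"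
    using calls_loop_bound[OF dist] by (simp add: n_def)
  also have "real n * (6 * (real n + 1) * rate ^ n) \<le> 6 * ?p - 6 * (real n + 1)"
  proof -
    have "6 * (real n + 1) * 1 \<le> 6 * (real n + 1) * rate ^ n" by (intro mult_left_mono) auto
    then show ?thesis by (simp add: power2_eq_square algebra_simps)
  qed
  finally have "real (calls_loop vs) + 1 \<le> 7 * ?p" using one by simp
  then have "4 * real K * (real (calls_loop vs) + 1) \<le> 4 * real K * (7 * ?p)"
    by (intro mult_left_mono) auto
  moreover have "real t \<le> 4 * real K * (real (calls_loop vs) + 1)"
    using t(2) by (metis (mono_tags, opaque_lifting) of_nat_1 of_nat_add of_nat_le_iff of_nat_mult of_nat_numeral)
  ultimately have "real t \<le> poly time_poly (real n) * 1.4656 ^ n"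
    unfolding rate_def[symmetric]
    by (simp add: K_def time_poly_def power_numeral_reduce algebra_simps)
  moreover have "distinct (map (\<lambda>D. restrict (table D) (set vs)) ?Ds)"
    using distinct_result inj_on_table by (simp add: distinct_map set_result)
  ultimately show ?thesis
    using t(1) by (intro exI[of _ "map (\<lambda>D. restrict (table D) (set vs)) ?Ds"] exI[of _ t])
      (simp add: M_enc tables_enc set_result minimal_rdfs)
qed

theorem theorem3:
  "\<exists>(P :: program) (T :: nat \<Rightarrow> real).
     T \<in> O_star (\<lambda>n. 1.4656 ^ n) \<and>
     (\<forall>(V :: nat set) (E :: nat set set) (vs :: nat list).
        cobipartite V E \<longrightarrow> distinct vs \<longrightarrow> set vs = V \<longrightarrow>
        (\<exists>(fs :: (nat \<Rightarrow> nat) list) (t :: nat).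
           run P (enc_graph vs E) (enc_functions vs fs) t \<and>
           real t \<le> T (card V) \<and>
           distinct fs \<and> set fs = {f. minimal_rdf V E f}))"
proof (intro exI[of _ prog] exI[of _ "\<lambda>n. poly time_poly (real n) * 1.4656 ^ n"] conjI allI impI)
  let ?T = "\<lambda>n. poly time_poly (real n) * 1.4656 ^ n"
  show "?T \<in> O_star (\<lambda>n. 1.4656 ^ n)"
    unfolding O_star_def using landau_o.big_refl by blast
  fix V :: "nat set" and E vs
  assume "cobipartite V E" "distinct vs" "set vs = V"
  then interpret listed_cobipartite_graph vs E
    by unfold_locales (auto simp: cobipartite_def)
  show "\<exists>fs t. run prog (enc_graph vs E) (enc_functions vs fs) t \<and>
           real t \<le> ?T (card V) \<and>
           distinct fs \<and> set fs = {f. minimal_rdf V E f}"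
    using prog_correct \<open>set vs = V\<close> distinct_card[OF \<open>distinct vs\<close>] by (simp add: n_def)
qed

end
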